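(* Let $\mathcal{A}$ be a preorder-enriched category, and let $(r_X:X\to RX)_{X\in\mathcal{A}}$ be a family of arrows such that for each object $X$, $RX$ is a separated object and there exists $s_X:RX\to X$ with $(r_X,s_X)$ an equivalence. For a preorder-enriched monad $\hat M=(M,\eta,(-)^* )$ on $\mathcal{A}$ define $\mathsf{T}\hat M=(M',\eta',(-)^{*'})$ by $M'X=R(MX)$, $\eta'_X=r_{MX}\circ\eta_X$, and for $f:X\to M'Y$, $f^{*'}=r_{MY}\circ(s_{MY}\circ f)^*\circ s_{MX}$. Then $\mathsf{T}\hat M$ is a preorder-enriched monad on $\mathcal{A}$, the family $(r_{MX})_{X}$ is a monad map from $\hat M$ to $\mathsf{T}\hat M$ (i.e. $r_{MX}\circ\eta_X=\eta'_X$ and $r_{MY}\circ f^*=(r_{MY}\circ f)^{*'}\circ r_{MX}$ for all $f:X\to MY$), and the definition of $\mathsf{T}\hat M$ does not depend on the choice of the arrows $s_X$.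
   Context: A preorder-enriched category is a category whose hom-sets $\mathcal{A}(X,Y)$ carry preorders $\le$ such that composition is monotone. Arrows $f,g$ are equivalent, $f\sim g$, if $f\le g$ and $g\le f$. An object $Y$ is separated if every hom-preorder $\mathcal{A}(X,Y)$ is a poset (i.e. $f\sim g$ implies $f=g$). A pair $f:X\to Y$, $g:Y\to X$ is an equivalence if $f\circ g\sim \mathrm{id}_Y$ and $g\circ f\sim\mathrm{id}_X$. A preorder-enriched monad on $\mathcal{A}$ is a triple $(M,\eta,(-)^* )$ where $M$ is a function on objects, $\eta_X:X\to MX$, and $(-)^*$ is a family of monotone maps $\mathcal{A}(X,MY)\to\mathcal{A}(MX,MY)$, satisfying $f^*\circ\eta_X=f$, $\eta_X^*=\mathrm{id}_{MX}$, and $g^*\circ f^*=(g^*\circ f)^*$. *)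

theory Defs
  imports Main
begin

text \<open>
  Categories are given by a set of objects and a set of arrows inside arbitrary types, so that
  hom-sets are automatically disjoint. One relation on arrows carries the whole family of
  hom-preorders; it is only ever used, and only constrained, between parallel arrows.
\<close>

record ('o, 'a) precat =
  Obj :: "'o set"
  Arr :: "'a set"
  Dom :: "'a \<Rightarrow> 'o"
  Cod :: "'a \<Rightarrow> 'o"
  ident :: "'o \<Rightarrow> 'a"
  comp :: "'a \<Rightarrow> 'a \<Rightarrow> 'a"  (infixl "\<cdot>\<index>" 70)
  le :: "'a \<Rightarrow> 'a \<Rightarrow> bool"  (infix "\<sqsubseteq>\<index>" 50)

definition hom :: "('o, 'a, 'x) precat_scheme \<Rightarrow> 'o \<Rightarrow> 'o \<Rightarrow> 'a set" where
  "hom A X Y = {f \<in> Arr A. Dom A f = X \<and> Cod A f = Y}"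

locale preorder_enriched_category =
  fixes A :: "('o, 'a, 'x) precat_scheme" (structure)
  assumes Dom_closed: "f \<in> Arr A \<Longrightarrow> Dom A f \<in> Obj A"
    and Cod_closed: "f \<in> Arr A \<Longrightarrow> Cod A f \<in> Obj A"
    and ident_closed: "X \<in> Obj A \<Longrightarrow> ident A X \<in> hom A X X"
    and comp_closed: "\<lbrakk>f \<in> hom A X Y; g \<in> hom A Y Z\<rbrakk> \<Longrightarrow> g \<cdot> f \<in> hom A X Z"
    and ident_left: "f \<in> hom A X Y \<Longrightarrow> ident A Y \<cdot> f = f"
    and ident_right: "f \<in> hom A X Y \<Longrightarrow> f \<cdot> ident A X = f"
    and comp_assoc: "\<lbrakk>f \<in> hom A W X; g \<in> hom A X Y; h \<in> hom A Y Z\<rbrakk>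
      \<Longrightarrow> (h \<cdot> g) \<cdot> f = h \<cdot> (g \<cdot> f)"
    and le_refl: "reflp_on (hom A X Y) (le A)"
    and le_trans: "transp_on (hom A X Y) (le A)"
    and comp_mono: "\<lbrakk>f \<in> hom A X Y; f' \<in> hom A X Y; g \<in> hom A Y Z; g' \<in> hom A Y Z;
      f \<sqsubseteq> f'; g \<sqsubseteq> g'\<rbrakk> \<Longrightarrow> g \<cdot> f \<sqsubseteq> g' \<cdot> f'"

definition equiv_arrows :: "('o, 'a, 'x) precat_scheme \<Rightarrow> 'a \<Rightarrow> 'a \<Rightarrow> bool"
    (infix "\<simeq>\<index>" 50) where
  "f \<simeq>\<^bsub>A\<^esub> g \<longleftrightarrow> f \<sqsubseteq>\<^bsub>A\<^esub> g \<and> g \<sqsubseteq>\<^bsub>A\<^esub> f"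

definition separated :: "('o, 'a, 'x) precat_scheme \<Rightarrow> 'o \<Rightarrow> bool" where
  "separated A Y \<longleftrightarrow> Y \<in> Obj A \<and>
    (\<forall>X \<in> Obj A. \<forall>f \<in> hom A X Y. \<forall>g \<in> hom A X Y. f \<simeq>\<^bsub>A\<^esub> g \<longrightarrow> f = g)"

definition equivalence_pair ::
    "('o, 'a, 'x) precat_scheme \<Rightarrow> 'o \<Rightarrow> 'o \<Rightarrow> 'a \<Rightarrow> 'a \<Rightarrow> bool" where
  "equivalence_pair A X Y f g \<longleftrightarrow> f \<in> hom A X Y \<and> g \<in> hom A Y X \<and>
    f \<cdot>\<^bsub>A\<^esub> g \<simeq>\<^bsub>A\<^esub> ident A Y \<and> g \<cdot>\<^bsub>A\<^esub> f \<simeq>\<^bsub>A\<^esub> ident A X"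

text \<open>
  The extension operator takes both objects as arguments, because \<open>f : X \<rightarrow> M Y\<close>
  does not determine \<open>Y\<close>: the object map need not be injective.
\<close>

record ('o, 'a) monad_data =
  Mobj :: "'o \<Rightarrow> 'o"
  unit :: "'o \<Rightarrow> 'a"
  ext :: "'o \<Rightarrow> 'o \<Rightarrow> 'a \<Rightarrow> 'a"

definition enriched_monad ::
    "('o, 'a, 'x) precat_scheme \<Rightarrow> ('o, 'a) monad_data \<Rightarrow> bool" where
  "enriched_monad A M \<longleftrightarrow>
    (\<forall>X \<in> Obj A. Mobj M X \<in> Obj A) \<and>
    (\<forall>X \<in> Obj A. unit M X \<in> hom A X (Mobj M X)) \<and>
    (\<forall>X \<in> Obj A. \<forall>Y \<in> Obj A.
      ext M X Y ` hom A X (Mobj M Y) \<subseteq> hom A (Mobj M X) (Mobj M Y) \<and>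
      monotone_on (hom A X (Mobj M Y)) (le A) (le A) (ext M X Y)) \<and>
    (\<forall>X \<in> Obj A. \<forall>Y \<in> Obj A. \<forall>f \<in> hom A X (Mobj M Y).
      ext M X Y f \<cdot>\<^bsub>A\<^esub> unit M X = f) \<and>
    (\<forall>X \<in> Obj A. ext M X X (unit M X) = ident A (Mobj M X)) \<and>
    (\<forall>X \<in> Obj A. \<forall>Y \<in> Obj A. \<forall>Z \<in> Obj A.
      \<forall>f \<in> hom A X (Mobj M Y). \<forall>g \<in> hom A Y (Mobj M Z).
      ext M Y Z g \<cdot>\<^bsub>A\<^esub> ext M X Y f = ext M X Z (ext M Y Z g \<cdot>\<^bsub>A\<^esub> f))"

definition monad_map ::
    "('o, 'a, 'x) precat_scheme \<Rightarrow> ('o, 'a) monad_data \<Rightarrow> ('o, 'a) monad_data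
      \<Rightarrow> ('o \<Rightarrow> 'a) \<Rightarrow> bool" where
  "monad_map A M N \<sigma> \<longleftrightarrow>
    (\<forall>X \<in> Obj A. \<sigma> X \<in> hom A (Mobj M X) (Mobj N X)) \<and>
    (\<forall>X \<in> Obj A. \<sigma> X \<cdot>\<^bsub>A\<^esub> unit M X = unit N X) \<and>
    (\<forall>X \<in> Obj A. \<forall>Y \<in> Obj A. \<forall>f \<in> hom A X (Mobj M Y).
      \<sigma> Y \<cdot>\<^bsub>A\<^esub> ext M X Y f = ext N X Y (\<sigma> Y \<cdot>\<^bsub>A\<^esub> f) \<cdot>\<^bsub>A\<^esub> \<sigma> X)"

text \<open>
  Equality of monads on \<open>A\<close>; record equality would also compare the junk values that the
  underlying total functions take outside the objects and hom-sets of \<open>A\<close>.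
\<close>

definition same_monad ::
    "('o, 'a, 'x) precat_scheme \<Rightarrow> ('o, 'a) monad_data \<Rightarrow> ('o, 'a) monad_data \<Rightarrow> bool" where
  "same_monad A M N \<longleftrightarrow>
    (\<forall>X \<in> Obj A. Mobj M X = Mobj N X) \<and>
    (\<forall>X \<in> Obj A. unit M X = unit N X) \<and>
    (\<forall>X \<in> Obj A. \<forall>Y \<in> Obj A. \<forall>f \<in> hom A X (Mobj M Y). ext M X Y f = ext N X Y f)"

definition sep_monad ::
    "('o, 'a, 'x) precat_scheme \<Rightarrow> ('o \<Rightarrow> 'o) \<Rightarrow> ('o \<Rightarrow> 'a) \<Rightarrow> ('o \<Rightarrow> 'a)
      \<Rightarrow> ('o, 'a) monad_data \<Rightarrow> ('o, 'a) monad_data" where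
  "sep_monad A R r s M =
    \<lparr> Mobj = (\<lambda>X. R (Mobj M X)),
      unit = (\<lambda>X. r (Mobj M X) \<cdot>\<^bsub>A\<^esub> unit M X),
      ext = (\<lambda>X Y f. r (Mobj M Y) \<cdot>\<^bsub>A\<^esub> ext M X Y (s (Mobj M Y) \<cdot>\<^bsub>A\<^esub> f) \<cdot>\<^bsub>A\<^esub> s (Mobj M X)) \<rparr>"

definition equivalence_choice ::
    "('o, 'a, 'x) precat_scheme \<Rightarrow> ('o \<Rightarrow> 'o) \<Rightarrow> ('o \<Rightarrow> 'a) \<Rightarrow> ('o \<Rightarrow> 'a) \<Rightarrow> bool" where
  "equivalence_choice A R r s \<longleftrightarrow> (\<forall>X \<in> Obj A. equivalence_pair A X (R X) (r X) (s X))"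

end

theory Submission
  imports Defs
begin

text \<open>
  Write \<open>s\<close> for the chosen inverses. Since \<open>R X\<close> is separated, \<open>r X \<cdot> s X\<close> is equal to the identity,
  while \<open>s X \<cdot> r X\<close> is only equivalent to it. Composition and extension are monotone, hence respect
  equivalence, so a factor \<open>s X \<cdot> r X\<close> can be cancelled up to equivalence. Every identity to be
  proved is between arrows into some \<open>R Y\<close>, where equivalence is equality.
\<close>

text \<open>The preorder is only constrained between parallel arrows, so \<open>\<simeq>\<close>
  alone carries no typing. Bundling the two memberships lets equivalences be chained by resolution
  without separate typing goals.\<close>

definition equiv_in ::
    "('o, 'a, 'x) precat_scheme \<Rightarrow> 'o \<Rightarrow> 'o \<Rightarrow> 'a \<Rightarrow> 'a \<Rightarrow> bool" where
  "equiv_in A X Y f g \<longleftrightarrow> f \<in> hom A X Y \<and> g \<in> hom A X Y \<and> f \<simeq>\<^bsub>A\<^esub> g"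

context preorder_enriched_category
begin

lemma hom_objD:
  assumes "f \<in> hom A X Y"
  shows "X \<in> Obj A" "Y \<in> Obj A"
  using assms Dom_closed Cod_closed by (auto simp: hom_def)

lemma equiv_in_refl: "f \<in> hom A X Y \<Longrightarrow> equiv_in A X Y f f"
  using le_refl by (auto simp: equiv_in_def equiv_arrows_def reflp_on_def)

lemma equiv_in_comp:
  "\<lbrakk>equiv_in A X Y f f'; equiv_in A Y Z g g'\<rbrakk> \<Longrightarrow> equiv_in A X Z (g \<cdot> f) (g' \<cdot> f')"
  using comp_closed comp_mono unfolding equiv_in_def equiv_arrows_def by blast

lemma separated_equiv_in_eq: "\<lbrakk>separated A Y; equiv_in A X Y f g\<rbrakk> \<Longrightarrow> f = g"
  using hom_objD(1) unfolding separated_def equiv_in_def by blast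

end

text \<open>One choice \<open>s\<close> of inverses is fixed as a parameter, so that a second choice
  can be handled by interpreting the locale again.\<close>

locale sep_completion = preorder_enriched_category A
  for A :: "('o, 'a, 'x) precat_scheme" (structure) +
  fixes R :: "'o \<Rightarrow> 'o"
    and r s :: "'o \<Rightarrow> 'a"
    and M :: "('o, 'a) monad_data"
  assumes separated_R: "X \<in> Obj A \<Longrightarrow> separated A (R X)"
    and equivalence_pair_rs: "X \<in> Obj A \<Longrightarrow> equivalence_pair A X (R X) (r X) (s X)"
    and enriched_monad_M: "enriched_monad A M"
begin

section \<open>Typing facts and the laws of the given monad\<close>

lemma R_obj: "X \<in> Obj A \<Longrightarrow> R X \<in> Obj A"
  using separated_R by (simp add: separated_def)

lemma r_hom: "X \<in> Obj A \<Longrightarrow> r X \<in> hom A X (R X)"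
  and s_hom: "X \<in> Obj A \<Longrightarrow> s X \<in> hom A (R X) X"
  using equivalence_pair_rs by (auto simp: equivalence_pair_def)

lemma M_obj: "X \<in> Obj A \<Longrightarrow> Mobj M X \<in> Obj A"
  using enriched_monad_M by (simp add: enriched_monad_def)

lemma unit_hom: "X \<in> Obj A \<Longrightarrow> unit M X \<in> hom A X (Mobj M X)"
  using enriched_monad_M by (simp add: enriched_monad_def)

text \<open>The typing of \<open>f\<close> already makes \<open>X\<close> an object. For
  \<open>Y\<close> it only yields that \<open>Mobj M Y\<close> is an object, hence the separate
  hypothesis.\<close>

lemma ext_hom:
  "\<lbrakk>Y \<in> Obj A; f \<in> hom A X (Mobj M Y)\<rbrakk> \<Longrightarrow> ext M X Y f \<in> hom A (Mobj M X) (Mobj M Y)"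
  using enriched_monad_M hom_objD(1) unfolding enriched_monad_def by blast

lemma ext_mono:
  "\<lbrakk>Y \<in> Obj A; f \<in> hom A X (Mobj M Y); g \<in> hom A X (Mobj M Y); f \<sqsubseteq> g\<rbrakk>
    \<Longrightarrow> ext M X Y f \<sqsubseteq> ext M X Y g"
  using enriched_monad_M hom_objD(1) unfolding enriched_monad_def monotone_on_def by blast

lemma ext_unit_comp:
  "\<lbrakk>Y \<in> Obj A; f \<in> hom A X (Mobj M Y)\<rbrakk> \<Longrightarrow> ext M X Y f \<cdot> unit M X = f"
  using enriched_monad_M hom_objD(1) unfolding enriched_monad_def by blast

lemma ext_unit: "X \<in> Obj A \<Longrightarrow> ext M X X (unit M X) = ident A (Mobj M X)"
  using enriched_monad_M by (simp add: enriched_monad_def)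

lemma ext_comp_ext:
  "\<lbrakk>Y \<in> Obj A; Z \<in> Obj A; f \<in> hom A X (Mobj M Y); g \<in> hom A Y (Mobj M Z)\<rbrakk>
    \<Longrightarrow> ext M Y Z g \<cdot> ext M X Y f = ext M X Z (ext M Y Z g \<cdot> f)"
  using enriched_monad_M hom_objD(1) unfolding enriched_monad_def by blast

lemma ext_equiv_in:
  "\<lbrakk>Y \<in> Obj A; equiv_in A X (Mobj M Y) f g\<rbrakk>
    \<Longrightarrow> equiv_in A (Mobj M X) (Mobj M Y) (ext M X Y f) (ext M X Y g)"
  by (simp add: equiv_in_def equiv_arrows_def ext_hom ext_mono)

section \<open>Cancelling \<open>r\<close> against \<open>s\<close>\<close>

lemma r_comp_s:
  assumes "X \<in> Obj A"
  shows "r X \<cdot> s X = ident A (R X)"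
proof (rule separated_equiv_in_eq[OF separated_R[OF assms]])
  show "equiv_in A (R X) (R X) (r X \<cdot> s X) (ident A (R X))"
    using assms comp_closed ident_closed R_obj equivalence_pair_rs
    unfolding equiv_in_def equivalence_pair_def by blast
qed

lemma s_comp_r:
  assumes "X \<in> Obj A"
  shows "equiv_in A X X (s X \<cdot> r X) (ident A X)"
  using assms comp_closed ident_closed equivalence_pair_rs
  unfolding equiv_in_def equivalence_pair_def by blast

lemma r_s_cancel:
  assumes "f \<in> hom A Z (R X)" "X \<in> Obj A"
  shows "r X \<cdot> (s X \<cdot> f) = f"
  using assms comp_assoc[OF assms(1) s_hom r_hom] by (simp add: r_comp_s ident_left)

text \<open>Here \<open>X\<close> need not be separated, so the cancellation holds only up to
  equivalence, in contrast to \<open>r_s_cancel\<close>.\<close>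

lemma s_r_cancel:
  assumes "f \<in> hom A Z X"
  shows "equiv_in A Z X (s X \<cdot> (r X \<cdot> f)) f"
proof -
  have X: "X \<in> Obj A"
    using assms by (rule hom_objD)
  have "equiv_in A Z X ((s X \<cdot> r X) \<cdot> f) (ident A X \<cdot> f)"
    using equiv_in_comp equiv_in_refl assms s_comp_r[OF X] by blast
  then show ?thesis
    using assms by (simp add: ident_left comp_assoc[OF assms r_hom[OF X] s_hom[OF X]])
qed

section \<open>The extension operator of the new monad and its laws\<close>

abbreviation sep_ext :: "'o \<Rightarrow> 'o \<Rightarrow> 'a \<Rightarrow> 'a" where
  "sep_ext X Y f \<equiv> r (Mobj M Y) \<cdot> ext M X Y (s (Mobj M Y) \<cdot> f) \<cdot> s (Mobj M X)"

lemma s_comp_hom: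
  "\<lbrakk>Y \<in> Obj A; f \<in> hom A X (R (Mobj M Y))\<rbrakk> \<Longrightarrow> s (Mobj M Y) \<cdot> f \<in> hom A X (Mobj M Y)"
  using comp_closed s_hom M_obj by blast

lemma ext_s_comp_hom:
  "\<lbrakk>Y \<in> Obj A; f \<in> hom A X (R (Mobj M Y))\<rbrakk>
    \<Longrightarrow> ext M X Y (s (Mobj M Y) \<cdot> f) \<in> hom A (Mobj M X) (Mobj M Y)"
  by (simp add: ext_hom s_comp_hom)

lemma sep_ext_hom:
  assumes "Y \<in> Obj A" "f \<in> hom A X (R (Mobj M Y))"
  shows "sep_ext X Y f \<in> hom A (R (Mobj M X)) (R (Mobj M Y))"
  by (rule comp_closed[OF s_hom[OF M_obj[OF hom_objD(1)[OF assms(2)]]]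
        comp_closed[OF ext_s_comp_hom[OF assms] r_hom[OF M_obj[OF assms(1)]]]])

lemma sep_ext_mono:
  assumes "Y \<in> Obj A" "f \<in> hom A X (R (Mobj M Y))" "g \<in> hom A X (R (Mobj M Y))" "f \<sqsubseteq> g"
  shows "sep_ext X Y f \<sqsubseteq> sep_ext X Y g"
proof -
  have X: "X \<in> Obj A"
    using assms(2) by (rule hom_objD)
  \<comment> \<open>\<open>comp_mono\<close> compares both factors at once, so the factor that stays
    fixed is compared with itself.\<close>
  have refl: "h \<sqsubseteq> h" if "h \<in> hom A V W" for V W h
    using le_refl that by (auto simp: reflp_on_def)
  note sX = s_hom[OF M_obj[OF X]] and sY = s_hom[OF M_obj[OF assms(1)]]
    and rY = r_hom[OF M_obj[OF assms(1)]]
  note ef = ext_s_comp_hom[OF assms(1,2)] and eg = ext_s_comp_hom[OF assms(1,3)]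
  have "s (Mobj M Y) \<cdot> f \<sqsubseteq> s (Mobj M Y) \<cdot> g"
    by (rule comp_mono[OF assms(2,3) sY sY assms(4) refl[OF sY]])
  then have "ext M X Y (s (Mobj M Y) \<cdot> f) \<sqsubseteq> ext M X Y (s (Mobj M Y) \<cdot> g)"
    by (rule ext_mono[OF assms(1) s_comp_hom[OF assms(1,2)] s_comp_hom[OF assms(1,3)]])
  then have "r (Mobj M Y) \<cdot> ext M X Y (s (Mobj M Y) \<cdot> f)
      \<sqsubseteq> r (Mobj M Y) \<cdot> ext M X Y (s (Mobj M Y) \<cdot> g)"
    by (rule comp_mono[OF ef eg rY rY _ refl[OF rY]])
  then show ?thesis
    by (rule comp_mono[OF sX sX comp_closed[OF ef rY] comp_closed[OF eg rY] refl[OF sX]])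
qed

text \<open>The trailing \<open>s\<close> of \<open>sep_ext\<close> meets \<open>r\<close> and
  cancels up to equivalence; the composite ends in a separated object, so equality results. The unit
  law uses this with \<open>g\<close> the unit, the composition law with \<open>g\<close> an
  extension followed by nothing but its own trailing \<open>s\<close>.\<close>

lemma sep_ext_comp_r:
  assumes "Y \<in> Obj A" "f \<in> hom A X (R (Mobj M Y))" "g \<in> hom A Z (Mobj M X)"
  shows "sep_ext X Y f \<cdot> (r (Mobj M X) \<cdot> g) = r (Mobj M Y) \<cdot> (ext M X Y (s (Mobj M Y) \<cdot> f) \<cdot> g)"
proof -
  have X: "X \<in> Obj A"
    using assms(2) by (rule hom_objD)
  let ?e = "ext M X Y (s (Mobj M Y) \<cdot> f)"
  note e = ext_s_comp_hom[OF assms(1,2)]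
  note rY = r_hom[OF M_obj[OF assms(1)]]
  note re = comp_closed[OF e rY]
  note rg = comp_closed[OF assms(3) r_hom[OF M_obj[OF X]]]
  have "equiv_in A Z (R (Mobj M Y))
      ((r (Mobj M Y) \<cdot> ?e) \<cdot> (s (Mobj M X) \<cdot> (r (Mobj M X) \<cdot> g))) ((r (Mobj M Y) \<cdot> ?e) \<cdot> g)"
    by (rule equiv_in_comp[OF s_r_cancel[OF assms(3)] equiv_in_refl[OF re]])
  from separated_equiv_in_eq[OF separated_R[OF M_obj[OF assms(1)]] this] show ?thesis
    by (simp add: comp_assoc[OF rg s_hom[OF M_obj[OF X]] re] comp_assoc[OF assms(3) e rY])
qed

text \<open>Extension and composition preserve equivalence, and the final \<open>r\<close> leads
  into a separated object. The typical use has \<open>f\<close> of the form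
  \<open>r (Mobj M Y) \<cdot> g\<close>, where \<open>s_r_cancel\<close> supplies the
  hypothesis.\<close>

lemma sep_ext_cong:
  assumes "Y \<in> Obj A" "equiv_in A X (Mobj M Y) (s (Mobj M Y) \<cdot> f) g"
  shows "sep_ext X Y f = r (Mobj M Y) \<cdot> ext M X Y g \<cdot> s (Mobj M X)"
proof -
  have X: "X \<in> Obj A"
    using assms(2) hom_objD(1) unfolding equiv_in_def by blast
  show ?thesis
    by (rule separated_equiv_in_eq[OF separated_R[OF M_obj[OF assms(1)]]
          equiv_in_comp[OF equiv_in_refl[OF s_hom[OF M_obj[OF X]]]
            equiv_in_comp[OF ext_equiv_in[OF assms] equiv_in_refl[OF r_hom[OF M_obj[OF assms(1)]]]]]])
qed

lemma sep_ext_unit_comp: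
  assumes "Y \<in> Obj A" "f \<in> hom A X (R (Mobj M Y))"
  shows "sep_ext X Y f \<cdot> (r (Mobj M X) \<cdot> unit M X) = f"
  using assms hom_objD(1)[OF assms(2)]
  by (simp add: sep_ext_comp_r[OF assms unit_hom] ext_unit_comp s_comp_hom r_s_cancel M_obj)

text \<open>The inner \<open>s\<close> and \<open>r\<close> cancel under the extension, which leaves
  the extension of the old unit, an identity, between \<open>r\<close> and \<open>s\<close>; these
  compose exactly to the identity.\<close>

lemma sep_ext_unit:
  assumes "X \<in> Obj A"
  shows "sep_ext X X (r (Mobj M X) \<cdot> unit M X) = ident A (R (Mobj M X))"
  using assms sep_ext_cong[OF assms s_r_cancel[OF unit_hom]]
  by (simp add: ext_unit ident_right[OF r_hom] r_comp_s M_obj)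

text \<open>Cancelling the inner \<open>s\<close> and \<open>r\<close> reduces both sides to
  \<open>r\<close>, the two old extensions and \<open>s\<close>, where the composition law of
  \<open>M\<close> applies. The calculation starts from the right-hand side.\<close>

lemma sep_ext_comp_sep_ext:
  assumes "Y \<in> Obj A" "Z \<in> Obj A" "f \<in> hom A X (R (Mobj M Y))" "g \<in> hom A Y (R (Mobj M Z))"
  shows "sep_ext Y Z g \<cdot> sep_ext X Y f = sep_ext X Z (sep_ext Y Z g \<cdot> f)"
proof -
  note X = hom_objD(1)[OF assms(3)]
  note f = s_comp_hom[OF assms(1,3)] and g = s_comp_hom[OF assms(2,4)]
  note ef = ext_s_comp_hom[OF assms(1,3)] and eg = ext_s_comp_hom[OF assms(2,4)]
  note rY = r_hom[OF M_obj[OF assms(1)]] and rZ = r_hom[OF M_obj[OF assms(2)]]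
  note sX = s_hom[OF M_obj[OF X]] and sY = s_hom[OF M_obj[OF assms(1)]]
    and sZ = s_hom[OF M_obj[OF assms(2)]]
  let ?f = "s (Mobj M Y) \<cdot> f" and ?g = "s (Mobj M Z) \<cdot> g"
  let ?eg = "ext M Y Z ?g"
  \<comment> \<open>Pure reassociation: it brings \<open>r\<close> to the front, where the
    \<open>s\<close> inside the outer extension can cancel it.\<close>
  have "sep_ext Y Z g \<cdot> f = r (Mobj M Z) \<cdot> (?eg \<cdot> ?f)"
    by (simp add: comp_assoc[OF assms(3) sY comp_closed[OF eg rZ]] comp_assoc[OF f eg rZ])
  then have "equiv_in A X (Mobj M Z) (s (Mobj M Z) \<cdot> (sep_ext Y Z g \<cdot> f)) (?eg \<cdot> ?f)"
    using s_r_cancel[OF comp_closed[OF f eg]] by simp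
  then have "sep_ext X Z (sep_ext Y Z g \<cdot> f)
      = r (Mobj M Z) \<cdot> ext M X Z (?eg \<cdot> ?f) \<cdot> s (Mobj M X)"
    by (rule sep_ext_cong[OF assms(2)])
  also have "\<dots> = r (Mobj M Z) \<cdot> (?eg \<cdot> (ext M X Y ?f \<cdot> s (Mobj M X)))"
    using comp_assoc[OF sX comp_closed[OF ef eg] rZ] comp_assoc[OF sX ef eg]
    by (simp add: ext_comp_ext[OF assms(1,2) f g])
  \<comment> \<open>Read from right to left, \<open>sep_ext_comp_r\<close> inserts \<open>s\<close>
    after \<open>r\<close> between the two old extensions, which splits the composite into two new
    ones.\<close>
  also have "\<dots> = sep_ext Y Z g \<cdot> (r (Mobj M Y) \<cdot> (ext M X Y ?f \<cdot> s (Mobj M X)))"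
    by (rule sep_ext_comp_r[OF assms(2,4) comp_closed[OF sX ef], symmetric])
  also have "\<dots> = sep_ext Y Z g \<cdot> sep_ext X Y f"
    by (simp add: comp_assoc[OF sX ef rY])
  finally show ?thesis ..
qed

theorem enriched_monad_sep_monad: "enriched_monad A (sep_monad A R r s M)"
  unfolding enriched_monad_def sep_monad_def
  by (auto simp: R_obj M_obj comp_closed[OF unit_hom r_hom] sep_ext_hom monotone_on_def sep_ext_mono
      sep_ext_unit_comp sep_ext_unit sep_ext_comp_sep_ext)

section \<open>The monad map\<close>

text \<open>Two pairs of \<open>s\<close> and \<open>r\<close> cancel: the one inside the extension
  by \<open>sep_ext_cong\<close>, the one at the right end by \<open>s_comp_r\<close>.\<close>

lemma sep_ext_r_comp:
  assumes "Y \<in> Obj A" "f \<in> hom A X (Mobj M Y)"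
  shows "sep_ext X Y (r (Mobj M Y) \<cdot> f) \<cdot> r (Mobj M X) = r (Mobj M Y) \<cdot> ext M X Y f"
proof -
  note X = hom_objD(1)[OF assms(2)]
  note re = comp_closed[OF ext_hom[OF assms] r_hom[OF M_obj[OF assms(1)]]]
  have "equiv_in A (Mobj M X) (R (Mobj M Y))
      ((r (Mobj M Y) \<cdot> ext M X Y f) \<cdot> (s (Mobj M X) \<cdot> r (Mobj M X)))
      ((r (Mobj M Y) \<cdot> ext M X Y f) \<cdot> ident A (Mobj M X))"
    by (rule equiv_in_comp[OF s_comp_r[OF M_obj[OF X]] equiv_in_refl[OF re]])
  from separated_equiv_in_eq[OF separated_R[OF M_obj[OF assms(1)]] this] show ?thesis
    by (simp add: sep_ext_cong[OF assms(1) s_r_cancel[OF assms(2)]] ident_right[OF re]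
        comp_assoc[OF r_hom[OF M_obj[OF X]] s_hom[OF M_obj[OF X]] re])
qed

theorem monad_map_sep_monad:
  "monad_map A M (sep_monad A R r s M) (\<lambda>X. r (Mobj M X))"
  unfolding monad_map_def sep_monad_def by (simp add: r_hom M_obj sep_ext_r_comp)

section \<open>Independence of the chosen inverses\<close>

text \<open>The usual uniqueness argument: \<open>s X\<close> equals
  \<open>s X \<cdot> (r X \<cdot> t)\<close>, which is equivalent to \<open>t\<close>.\<close>

lemma inverse_unique:
  assumes "X \<in> Obj A" "equivalence_pair A X (R X) (r X) t"
  shows "equiv_in A (R X) X (s X) t"
proof -
  \<comment> \<open>The locale needs an inverse at every object, so \<open>s\<close> is changed at
    \<open>X\<close> only; \<open>t.r_comp_s\<close> then gives that \<open>r X \<cdot> t\<close> is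
    an identity.\<close>
  interpret t: sep_completion A R r "s(X := t)" M
    using separated_R equivalence_pair_rs enriched_monad_M assms(2) by unfold_locales auto
  have t: "t \<in> hom A (R X) X"
    using assms(2) by (simp add: equivalence_pair_def)
  show ?thesis
    using s_r_cancel[OF t] t.r_comp_s[OF assms(1)] ident_right[OF s_hom[OF assms(1)]] by simp
qed

text \<open>The inverses enter only the extension operator, so objects and units agree by
  definition. Both occurrences of \<open>s\<close> are replaced by \<open>t\<close> up to
  equivalence, and separatedness of the target gives equality.\<close>

theorem same_monad_sep_monad:
  assumes "equivalence_choice A R r t"
  shows "same_monad A (sep_monad A R r s M) (sep_monad A R r t M)"
proof -
  have st: "equiv_in A (R (Mobj M X)) (Mobj M X) (s (Mobj M X)) (t (Mobj M X))"
    if "X \<in> Obj A" for X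
    using inverse_unique M_obj[OF that] assms by (simp add: equivalence_choice_def)
  have "sep_ext X Y f = r (Mobj M Y) \<cdot> ext M X Y (t (Mobj M Y) \<cdot> f) \<cdot> t (Mobj M X)"
    if "X \<in> Obj A" "Y \<in> Obj A" "f \<in> hom A X (R (Mobj M Y))" for X Y f
    \<comment> \<open>From the inside out: precompose with \<open>f\<close>, extend, postcompose
      with \<open>r\<close>, and finally exchange the inverse at the right end.\<close>
    by (rule separated_equiv_in_eq[OF separated_R[OF M_obj[OF that(2)]]
          equiv_in_comp[OF st[OF that(1)]
            equiv_in_comp[OF ext_equiv_in[OF that(2)
                equiv_in_comp[OF equiv_in_refl[OF that(3)] st[OF that(2)]]]
              equiv_in_refl[OF r_hom[OF M_obj[OF that(2)]]]]]])
  then show ?thesis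
    by (simp add: same_monad_def sep_monad_def)
qed

end

theorem theorem57:
  fixes A :: "('o, 'a, 'x) precat_scheme"
    and R :: "'o \<Rightarrow> 'o"
    and r :: "'o \<Rightarrow> 'a"
    and M :: "('o, 'a) monad_data"
  assumes "preorder_enriched_category A"
    and "\<And>X. X \<in> Obj A \<Longrightarrow> r X \<in> hom A X (R X)"
    and "\<And>X. X \<in> Obj A \<Longrightarrow> separated A (R X)"
    and "\<And>X. X \<in> Obj A \<Longrightarrow> \<exists>s \<in> hom A (R X) X. equivalence_pair A X (R X) (r X) s"
    and "enriched_monad A M"
  shows "(\<forall>s. equivalence_choice A R r s \<longrightarrow>
            enriched_monad A (sep_monad A R r s M) \<and>
            monad_map A M (sep_monad A R r s M) (\<lambda>X. r (Mobj M X))) \<and>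
         (\<forall>s s'. equivalence_choice A R r s \<longrightarrow> equivalence_choice A R r s' \<longrightarrow>
            same_monad A (sep_monad A R r s M) (sep_monad A R r s' M))"
proof -
  have choice: "sep_completion A R r s M" if "equivalence_choice A R r s" for s
    using assms(1,3,5) that
    by (auto simp: sep_completion_def sep_completion_axioms_def equivalence_choice_def)
  show ?thesis
    using choice sep_completion.enriched_monad_sep_monad sep_completion.monad_map_sep_monad
      sep_completion.same_monad_sep_monad by blast
qed

end
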